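(* Let $J_0=-J_0^\top\in\mathbb{R}^{n\times n}$, $J_1=J_1^\top\in\mathbb{R}^{n\times n}$ with $r=\operatorname{rank}J_1$, and let $Q=Q^\top\in\mathbb{R}^{n\times n}$ be positive definite. Let $S_1=S_1^\top\in\mathbb{R}^{r\times r}$ and let $M\in\mathbb{R}^{r\times n}$ be a full rank matrix such that the subspace $\mathcal{D}_{\mathcal{J}}$ defined in the context is a Dirac structure. Let $\mathbb{T}\subseteq\mathbb{R}$ be a time interval and let $a,b\in C^1(\mathbb{T},\mathbb{R})$ satisfy $a(t)<b(t)$ and $\dot a(t)\dot b(t)\geqslant0$ for all $t\in\mathbb{T}$. Let $x(t,s)\in\mathbb{R}^n$, $t\in\mathbb{T}$, $s\in[a(t),b(t)]$, be a (continuously differentiable) solution of the linear boundary port-Hamiltonian system $\partial_tx=J_0Qx+J_1\partial_s(Qx)$ on the spatial domain $[a(t),b(t)]$, and define, for $t\in\mathbb{T}$ and $\hat s\in[0,1]$, $$\hat x(t,\hat s)=\sqrt{b(t)-a(t)}\;x\big(t,\,a(t)+(b(t)-a(t))\hat s\big),\qquad \hat e(t,\hat s)=Q\hat x(t,\hat s).$$ Then the power balance corresponding to the Hamiltonian $\hat H(\hat x,t)=\frac12\int_0^1\hat x^\top(\hat s)Q\hat x(\hat s)\,\mathrm{d}\hat s$ is given, for all $t\in\mathbb{T}$, by $$\int_0^1\hat e^\top(t,\hat s)\,\partial_t\hat x(t,\hat s)\,\mathrm{d}\hat s=-\left[\frac{\hat e^\top(t,\hat s)M^\top S_1M\hat e(t,\hat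 s)}{b(t)-a(t)}\right]_{\hat s=0}^{\hat s=1}+\left[\frac12\frac{\dot a(t)+(\dot b(t)-\dot a(t))\hat s}{b(t)-a(t)}\hat e^\top(t,\hat s)\hat x(t,\hat s)\right]_{\hat s=0}^{\hat s=1}.$$
   Context: Power balance: the left-hand side of the identity is $\frac{\mathrm{d}}{\mathrm{d}t}\hat H(\hat x(t,\cdot),t)$. The matrices $S_1,M$: write $\mathcal{J}=J_0+J_1\partial_s$ and, for an interval $[\alpha,\beta]$ with $\alpha<\beta$, let $\mathcal{F}=L_2([\alpha,\beta],\mathbb{R}^n)\times\mathbb{R}^r$, $\mathcal{E}=\mathcal{F}^*$ (identified with $\mathcal{F}$), $\mathcal{B}=\mathcal{F}\times\mathcal{E}$, with $\langle(f,f_\partial)\mid(e,e_\partial)\rangle_{\mathcal{B}}=\int_\alpha^\beta f^\top(s) e(s)\,\mathrm{d}s-f_\partial^\top e_\partial$ and $\langle\!\langle(f^1,f^1_\partial,e^1,e^1_\partial),(f^2,f^2_\partial,e^2,e^2_\partial)\rangle\!\rangle_{\mathcal{B}}=\langle(f^1,f^1_\partial)\mid(e^2,e^2_\partial)\rangle_{\mathcal{B}}+\langle(f^2,f^2_\partial)\mid(e^1,e^1_\partial)\rangle_{\mathcal{B}}$. It is known (from the literature) that there exist a symmetric $S_1\in\mathbb{R}^{r\times r}$ and a full rank $M\in\mathbb{R}^{r\times n}$, not depending on the interval, such that $$\mathcal{D}_{\mathcal{J}}=\left\{(f,f_\partial,e,e_\partial)\in\mathcal{B}\,\middle|\,e,\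 \mathcal{J}e\in L_2([\alpha,\beta],\mathbb{R}^n),\ f=\mathcal{J}e,\ f_\partial=S_1\big(Me(\alpha)-Me(\beta)\big),\ e_\partial=Me(\alpha)+Me(\beta)\right\}$$ is a Dirac structure, i.e. $\mathcal{D}_{\mathcal{J}}=\mathcal{D}_{\mathcal{J}}^\perp$, where $\mathcal{D}_{\mathcal{J}}^\perp=\{d_1\in\mathcal{B}\mid\langle\!\langle d,d_1\rangle\!\rangle_{\mathcal{B}}=0\text{ for all }d\in\mathcal{D}_{\mathcal{J}}\}$. $S_1$ and $M$ denote any such matrices (for example, $M=I_n$ and $S_1=-\frac12J_1$ when $J_1$ has full rank). *)

theory Defs
  imports "HOL-Analysis.Analysis"
begin

text \<open>
  The number \<open>r\<close> of boundary ports is the rank of a matrix and may be \<open>0\<close>, so it cannot be the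
  cardinality of an index type. Vectors of \<open>\<real>\<^sup>r\<close> are therefore functions \<open>nat \<Rightarrow> real\<close>
  in \<open>{..<r} \<rightarrow>\<^sub>E UNIV\<close>, an \<open>r \<times> r\<close> matrix is \<open>S :: nat \<Rightarrow> nat \<Rightarrow> real\<close>, and an \<open>r \<times> n\<close>
  matrix is the sequence of its rows \<open>M 0, \<dots>, M (r - 1) :: real^'n\<close>.
\<close>

definition port_inner :: "nat \<Rightarrow> (nat \<Rightarrow> real) \<Rightarrow> (nat \<Rightarrow> real) \<Rightarrow> real" where
  "port_inner r y z = (\<Sum>i<r. y i * z i)"

definition port_mult :: "nat \<Rightarrow> (nat \<Rightarrow> nat \<Rightarrow> real) \<Rightarrow> (nat \<Rightarrow> real) \<Rightarrow> (nat \<Rightarrow> real)" where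
  "port_mult r S y = (\<lambda>i\<in>{..<r}. \<Sum>j<r. S i j * y j)"

definition rows_mult :: "nat \<Rightarrow> (nat \<Rightarrow> real^'n) \<Rightarrow> real^'n \<Rightarrow> (nat \<Rightarrow> real)" where
  "rows_mult r M v = (\<lambda>i\<in>{..<r}. M i \<bullet> v)"

text \<open>
  Elements of \<open>L\<^sub>2\<close> are represented by functions. All sets of such functions below are closed
  under changes on null sets, so that identities between them are identities in \<open>L\<^sub>2\<close>.
\<close>

definition L2 :: "real \<Rightarrow> real \<Rightarrow> (real \<Rightarrow> real^'n) set" where
  "L2 \<alpha> \<beta> = {f. f \<in> borel_measurable (lebesgue_on {\<alpha>..\<beta>}) \<and>
                integrable (lebesgue_on {\<alpha>..\<beta>}) (\<lambda>s. (norm (f s))\<^sup>2)}"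

type_synonym 'n bond = "(real \<Rightarrow> real^'n) \<times> (nat \<Rightarrow> real) \<times> (real \<Rightarrow> real^'n) \<times> (nat \<Rightarrow> real)"

definition bond_space :: "nat \<Rightarrow> real \<Rightarrow> real \<Rightarrow> 'n::finite bond set" where
  "bond_space r \<alpha> \<beta> = L2 \<alpha> \<beta> \<times> ({..<r} \<rightarrow>\<^sub>E UNIV) \<times> L2 \<alpha> \<beta> \<times> ({..<r} \<rightarrow>\<^sub>E UNIV)"

definition power_pairing :: "nat \<Rightarrow> real \<Rightarrow> real \<Rightarrow>
    (real \<Rightarrow> real^'n) \<times> (nat \<Rightarrow> real) \<Rightarrow> (real \<Rightarrow> real^'n) \<times> (nat \<Rightarrow> real) \<Rightarrow> real" where
  "power_pairing r \<alpha> \<beta> = (\<lambda>(f, fb) (e, eb).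
     (LINT s|lebesgue_on {\<alpha>..\<beta>}. f s \<bullet> e s) - port_inner r fb eb)"

definition bond_pairing :: "nat \<Rightarrow> real \<Rightarrow> real \<Rightarrow> 'n::finite bond \<Rightarrow> 'n bond \<Rightarrow> real" where
  "bond_pairing r \<alpha> \<beta> = (\<lambda>(f1, fb1, e1, eb1) (f2, fb2, e2, eb2).
     power_pairing r \<alpha> \<beta> (f1, fb1) (e2, eb2) + power_pairing r \<alpha> \<beta> (f2, fb2) (e1, eb1))"

definition bond_orth :: "nat \<Rightarrow> real \<Rightarrow> real \<Rightarrow> 'n::finite bond set \<Rightarrow> 'n bond set" where
  "bond_orth r \<alpha> \<beta> D = {d1 \<in> bond_space r \<alpha> \<beta>. \<forall>d\<in>D. bond_pairing r \<alpha> \<beta> d d1 = 0}"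

definition is_dirac :: "nat \<Rightarrow> real \<Rightarrow> real \<Rightarrow> 'n::finite bond set \<Rightarrow> bool" where
  "is_dirac r \<alpha> \<beta> D \<longleftrightarrow> D = bond_orth r \<alpha> \<beta> D"

text \<open>
  For \<open>e \<in> L\<^sub>2\<close>, the function \<open>J\<^sub>0 e + J\<^sub>1 \<partial>\<^sub>s e\<close> lies in \<open>L\<^sub>2\<close> iff \<open>J\<^sub>1 e\<close> has a weak derivative
  \<open>g \<in> L\<^sub>2\<close>, that is, iff \<open>e\<close> has a representative \<open>e'\<close> for which \<open>J\<^sub>1 e'\<close> is an indefinite integral
  of \<open>g\<close>; \<open>e\<close> itself need not be weakly differentiable if \<open>J\<^sub>1\<close> is singular. The boundary values
  of \<open>M e\<close> are those of its continuous representative.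
\<close>

definition dirac_J :: "real^'n^'n \<Rightarrow> real^'n^'n \<Rightarrow> nat \<Rightarrow> (nat \<Rightarrow> nat \<Rightarrow> real) \<Rightarrow> (nat \<Rightarrow> real^'n) \<Rightarrow>
    real \<Rightarrow> real \<Rightarrow> 'n::finite bond set" where
  "dirac_J J0 J1 r S1 M \<alpha> \<beta> = {(f, fb, e, eb) \<in> bond_space r \<alpha> \<beta>. \<exists>e' g.
     (AE s in lebesgue_on {\<alpha>..\<beta>}. e s = e' s) \<and>
     g \<in> L2 \<alpha> \<beta> \<and>
     (\<forall>s\<in>{\<alpha>..\<beta>}. J1 *v e' s = J1 *v e' \<alpha> + integral {\<alpha>..s} g) \<and>
     (\<forall>i<r. continuous_on {\<alpha>..\<beta>} (\<lambda>s. M i \<bullet> e' s)) \<and>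
     (AE s in lebesgue_on {\<alpha>..\<beta>}. f s = J0 *v e' s + g s) \<and>
     fb = port_mult r S1 (\<lambda>i. rows_mult r M (e' \<alpha>) i - rows_mult r M (e' \<beta>) i) \<and>
     eb = (\<lambda>i\<in>{..<r}. rows_mult r M (e' \<alpha>) i + rows_mult r M (e' \<beta>) i)}"

text \<open>
  Continuous differentiability refers to the whole set of pairs \<open>(t, s)\<close>, boundary included: at a
  boundary point \<open>(t, a t)\<close> the times \<open>\<tau>\<close> with \<open>a \<tau> \<le> a t\<close> need not accumulate at \<open>t\<close>, so \<open>\<partial>\<^sub>t x\<close>
  is taken from the total derivative instead of a one-variable limit.
\<close>

definition phs_solution :: "real^'n^'n \<Rightarrow> real^'n^'n \<Rightarrow> real^'n^'n \<Rightarrow> real set \<Rightarrow>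
    (real \<Rightarrow> real) \<Rightarrow> (real \<Rightarrow> real) \<Rightarrow> (real \<Rightarrow> real \<Rightarrow> real^'n::finite) \<Rightarrow> bool" where
  "phs_solution J0 J1 Q T a b x \<longleftrightarrow> (\<exists>xt xs.
     (let \<Omega> = Sigma T (\<lambda>t. {a t..b t}) in
       continuous_on \<Omega> (\<lambda>(t, s). xt t s) \<and>
       continuous_on \<Omega> (\<lambda>(t, s). xs t s) \<and>
       (\<forall>t\<in>T. \<forall>s\<in>{a t..b t}.
          ((\<lambda>(t, s). x t s) has_derivative (\<lambda>(dt, ds). dt *\<^sub>R xt t s + ds *\<^sub>R xs t s))
            (at (t, s) within \<Omega>) \<and>
          xt t s = J0 *v (Q *v x t s)
            + J1 *v vector_derivative (\<lambda>\<sigma>. Q *v x t \<sigma>) (at s within {a t..b t}))))"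

definition xhat :: "(real \<Rightarrow> real) \<Rightarrow> (real \<Rightarrow> real) \<Rightarrow> (real \<Rightarrow> real \<Rightarrow> real^'n) \<Rightarrow>
    real \<Rightarrow> real \<Rightarrow> real^'n" where
  "xhat a b x t s = sqrt (b t - a t) *\<^sub>R x t (a t + (b t - a t) * s)"

definition ehat :: "real^'n^'n \<Rightarrow> (real \<Rightarrow> real) \<Rightarrow> (real \<Rightarrow> real) \<Rightarrow> (real \<Rightarrow> real \<Rightarrow> real^'n) \<Rightarrow>
    real \<Rightarrow> real \<Rightarrow> real^'n" where
  "ehat Q a b x t s = Q *v xhat a b x t s"

definition Hhat :: "real^'n^'n \<Rightarrow> (real \<Rightarrow> real^'n) \<Rightarrow> real" where
  "Hhat Q z = 1 / 2 * integral {0..1} (\<lambda>s. z s \<bullet> (Q *v z s))"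

definition bracket01 :: "(real \<Rightarrow> real) \<Rightarrow> real" where
  "bracket01 F = F 1 - F 0"

end

theory Submission
  imports Defs
begin

text \<open>
  Testing the inclusion \<open>\<D> \<subseteq> \<D>\<^sup>\<bottom>\<close> with an affine \<open>e\<close> that equals \<open>v\<close> at one end of the interval and
  vanishes at the other one shows that the boundary form \<open>(M v)\<^sup>T S\<^sub>1 (M v)\<close> is \<open>- v\<^sup>T J\<^sub>1 v / 2\<close>. After
  the substitution \<open>y = a + (b - a) s\<close> the integrand of the power balance is the \<open>s\<close>-derivative of
  \<open>1/2 e\<^sup>T J\<^sub>1 e + 1/2 (a' + (b' - a') s) e\<^sup>T x\<close> with \<open>e = Q x\<close>, because \<open>e\<^sup>T J\<^sub>0 e = 0\<close>.
\<close>

lemma symmetric_inner_mult: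
  fixes A :: "real^'n^'n"
  assumes "A = transpose A"
  shows "u \<bullet> (A *v v) = v \<bullet> (A *v u)"
  by (metis assms dot_lmul_matrix inner_commute transpose_matrix_vector)

lemma skew_inner_mult_self:
  fixes A :: "real^'n^'n"
  assumes "A = - transpose A"
  shows "v \<bullet> (A *v v) = 0"
proof -
  have "v \<bullet> (A *v v) = (transpose A *v v) \<bullet> v"
    by (metis dot_lmul_matrix transpose_matrix_vector)
  also have "transpose A = 0 - A"
    by (metis assms diff_0 minus_minus)
  also have "((0 - A) *v v) \<bullet> v = - (v \<bullet> (A *v v))"
    unfolding matrix_vector_mult_diff_rdistrib by (simp add: inner_commute)
  finally show ?thesis by simp
qed

lemma continuous_on_imp_L2:
  assumes "continuous_on {\<alpha>..\<beta>} f"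
  shows "f \<in> L2 \<alpha> \<beta>"
  unfolding L2_def
  using assms
  by (auto intro!: continuous_imp_measurable_on_sets_lebesgue continuous_imp_integrable_real
      continuous_intros)

text \<open>The weight is the ramp \<open>(\<beta> - s) / (\<beta> - \<alpha>)\<close> times the
  absolute value of its slope, so minus half the squared ramp is an antiderivative. This is the
  source of the factor 1/2 in the boundary form.\<close>

lemma LINT_normalized_ramp:
  fixes \<alpha> \<beta> :: real
  assumes "\<alpha> < \<beta>"
  shows "(LINT s|lebesgue_on {\<alpha>..\<beta>}. (\<beta> - s) / (\<beta> - \<alpha>)\<^sup>2) = 1 / 2"
proof -
  have "((\<lambda>s. (\<beta> - s) / (\<beta> - \<alpha>)\<^sup>2) has_integral
      (- ((\<beta> - \<beta>)\<^sup>2 / (2 * (\<beta> - \<alpha>)\<^sup>2)) - - ((\<beta> - \<alpha>)\<^sup>2 / (2 * (\<beta> - \<alpha>)\<^sup>2)))) {\<alpha>..\<beta>}"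
    using assms
    by (intro fundamental_theorem_of_calculus)
      (auto intro!: derivative_eq_intros simp flip: has_real_derivative_iff_has_vector_derivative
        simp: field_simps)
  then have "integral {\<alpha>..\<beta>} (\<lambda>s. (\<beta> - s) / (\<beta> - \<alpha>)\<^sup>2) = 1 / 2"
    by (subst integral_unique) (use assms in auto)
  \<comment> \<open>The pairing is a Lebesgue integral, whereas the fundamental theorem evaluates a
    gauge integral; the two agree by continuity.\<close>
  moreover have "(LINT s|lebesgue_on {\<alpha>..\<beta>}. (\<beta> - s) / (\<beta> - \<alpha>)\<^sup>2) = integral {\<alpha>..\<beta>} (\<lambda>s. (\<beta> - s) / (\<beta> - \<alpha>)\<^sup>2)"
    by (intro lebesgue_integral_eq_integral continuous_imp_integrable_real continuous_intros)
      (use assms in auto)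
  ultimately show ?thesis by (rule trans[rotated])
qed

text \<open>Eliminates the port matrices: the boundary term becomes a quadratic form in
  \<open>J1\<close>, which can be compared with the term that the differential equation
  produces.\<close>

lemma dirac_boundary_form:
  fixes J0 J1 :: "real^'n^'n"
  assumes J0: "J0 = - transpose J0"
    and "\<alpha> < \<beta>"
    and dirac: "is_dirac r \<alpha> \<beta> (dirac_J J0 J1 r S M \<alpha> \<beta>)"
  shows "port_inner r (rows_mult r M v) (port_mult r S (rows_mult r M v)) = - (v \<bullet> (J1 *v v)) / 2"
proof -
  \<comment> \<open>Since \<open>e\<close> vanishes at \<open>\<beta>\<close>, the difference and
    the sum of the boundary values of \<open>M e\<close> are both \<open>M v\<close>, so the port
    product is exactly the form to be computed. The derivative of \<open>J1 e\<close> is the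
    constant \<open>g\<close>.\<close>
  define e where "e s = ((\<beta> - s) / (\<beta> - \<alpha>)) *\<^sub>R v" for s
  define g where "g = (\<lambda>s::real. - (J1 *v v) /\<^sub>R (\<beta> - \<alpha>))"
  define f where "f s = J0 *v e s + g s" for s
  define fb where "fb = port_mult r S (rows_mult r M v)"
  define eb where "eb = rows_mult r M v"
  have ends: "e \<alpha> = v" "e \<beta> = 0"
    using \<open>\<alpha> < \<beta>\<close> by (auto simp: e_def)
  have e: "continuous_on {\<alpha>..\<beta>} e"
    unfolding e_def by (intro continuous_intros) (use \<open>\<alpha> < \<beta>\<close> in auto)
  have J0e: "continuous_on {\<alpha>..\<beta>} (\<lambda>s. J0 *v e s)"
    by (rule bounded_linear.continuous_on[OF matrix_vector_mul_bounded_linear e])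
  have bond: "(f, fb, e, eb) \<in> bond_space r \<alpha> \<beta>"
    unfolding bond_space_def f_def g_def using e J0e
    by (auto intro!: continuous_on_imp_L2 continuous_intros
        simp: fb_def eb_def port_mult_def rows_mult_def)
  have J1e: "J1 *v e s = J1 *v e \<alpha> + integral {\<alpha>..s} g" if "s \<in> {\<alpha>..\<beta>}" for s
  proof -
    have "(\<beta> - s) / (\<beta> - \<alpha>) = 1 - (s - \<alpha>) / (\<beta> - \<alpha>)"
      using \<open>\<alpha> < \<beta>\<close> by (simp add: field_simps)
    then have "J1 *v e s = J1 *v v - ((s - \<alpha>) / (\<beta> - \<alpha>)) *\<^sub>R (J1 *v v)"
      by (simp only: e_def matrix_vector_mult_scaleR matrix_vector_mult_diff_distrib scaleR_left_diff_distrib scaleR_one)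
    then show ?thesis
      using that by (simp add: ends g_def divide_inverse)
  qed
  have "(f, fb, e, eb) \<in> dirac_J J0 J1 r S M \<alpha> \<beta>"
    unfolding dirac_J_def mem_Collect_eq prod.case
  \<comment> \<open>Being continuous, \<open>e\<close> is its own representative.\<close>
  proof (rule conjI[OF bond], rule exI[of _ e], rule exI[of _ g], intro conjI ballI allI impI)
    show "g \<in> L2 \<alpha> \<beta>"
      unfolding g_def by (intro continuous_on_imp_L2 continuous_intros)
    show "continuous_on {\<alpha>..\<beta>} (\<lambda>s. M i \<bullet> e s)" for i
      by (intro continuous_intros e)
    show "fb = port_mult r S (\<lambda>i. rows_mult r M (e \<alpha>) i - rows_mult r M (e \<beta>) i)"
      by (auto simp: fb_def ends port_mult_def rows_mult_def intro!: sum.cong)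
    show "eb = (\<lambda>i\<in>{..<r}. rows_mult r M (e \<alpha>) i + rows_mult r M (e \<beta>) i)"
      by (auto simp: eb_def ends rows_mult_def)
  qed (auto simp: f_def intro: J1e)
  \<comment> \<open>An element of a Dirac structure is orthogonal to itself. Its self-pairing is
    twice the difference of the integral and the port product, so these two are equal.\<close>
  with dirac have "bond_pairing r \<alpha> \<beta> (f, fb, e, eb) (f, fb, e, eb) = 0"
    unfolding is_dirac_def bond_orth_def by blast
  then have "port_inner r fb eb = (LINT s|lebesgue_on {\<alpha>..\<beta>}. f s \<bullet> e s)"
    by (simp add: bond_pairing_def power_pairing_def)
  \<comment> \<open>By skewness the \<open>J0\<close> part of \<open>f\<close> does no work on
    \<open>e\<close>; only slope times ramp remains.\<close>
  also have "(\<lambda>s. f s \<bullet> e s) = (\<lambda>s. (\<beta> - s) / (\<beta> - \<alpha>)\<^sup>2 * - (v \<bullet> (J1 *v v)))"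
  proof
    fix s
    have "f s \<bullet> e s = e s \<bullet> (J0 *v e s) + g s \<bullet> e s"
      by (simp add: f_def inner_add_left inner_commute[of "e s"])
    then show "f s \<bullet> e s = (\<beta> - s) / (\<beta> - \<alpha>)\<^sup>2 * - (v \<bullet> (J1 *v v))"
      unfolding skew_inner_mult_self[OF J0]
      by (simp add: g_def e_def power2_eq_square divide_inverse inner_commute)
  qed
  also have "(LINT s|lebesgue_on {\<alpha>..\<beta>}. (\<beta> - s) / (\<beta> - \<alpha>)\<^sup>2 * - (v \<bullet> (J1 *v v)))
      = - (v \<bullet> (J1 *v v)) / 2"
    unfolding integral_mult_left_zero LINT_normalized_ramp[OF \<open>\<alpha> < \<beta>\<close>] by simp
  finally show ?thesis
    by (simp add: fb_def eb_def port_inner_def mult.commute)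
qed

theorem lemma2:
  fixes J0 J1 Q :: "real^'n^'n"
    and r :: nat
    and S1 :: "nat \<Rightarrow> nat \<Rightarrow> real"
    and M :: "nat \<Rightarrow> real^'n"
    and T :: "real set"
    and a b a' b' :: "real \<Rightarrow> real"
    and x :: "real \<Rightarrow> real \<Rightarrow> real^'n"
  assumes "J0 = - transpose J0"
    and "J1 = transpose J1"
    and "r = rank J1"
    and "Q = transpose Q"
    and "\<And>v. v \<noteq> 0 \<Longrightarrow> 0 < v \<bullet> (Q *v v)"
    and "\<And>i j. i < r \<Longrightarrow> j < r \<Longrightarrow> S1 i j = S1 j i"
    and "dim (M ` {..<r}) = r"
    and "\<And>\<alpha> \<beta>. \<alpha> < \<beta> \<Longrightarrow> is_dirac r \<alpha> \<beta> (dirac_J J0 J1 r S1 M \<alpha> \<beta>)"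
    and "is_interval T" "interior T \<noteq> {}"
    and "\<And>t. t \<in> T \<Longrightarrow> (a has_real_derivative a' t) (at t within T)" "continuous_on T a'"
    and "\<And>t. t \<in> T \<Longrightarrow> (b has_real_derivative b' t) (at t within T)" "continuous_on T b'"
    and "\<And>t. t \<in> T \<Longrightarrow> a t < b t"
    and "\<And>t. t \<in> T \<Longrightarrow> 0 \<le> a' t * b' t"
    and "phs_solution J0 J1 Q T a b x"
  shows "\<forall>t\<in>T.
    (\<forall>s\<in>{0..1}. (\<lambda>\<tau>. xhat a b x \<tau> s) differentiable (at t within T)) \<and>
    ((\<lambda>\<tau>. Hhat Q (xhat a b x \<tau>)) has_real_derivative
       integral {0..1} (\<lambda>s. ehat Q a b x t s \<bullet>
         vector_derivative (\<lambda>\<tau>. xhat a b x \<tau> s) (at t within T))) (at t within T) \<and>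
    ((\<lambda>s. ehat Q a b x t s \<bullet> vector_derivative (\<lambda>\<tau>. xhat a b x \<tau> s) (at t within T))
       has_integral
         (- bracket01 (\<lambda>s. port_inner r (rows_mult r M (ehat Q a b x t s))
              (port_mult r S1 (rows_mult r M (ehat Q a b x t s))) / (b t - a t))
          + bracket01 (\<lambda>s. 1 / 2 * ((a' t + (b' t - a' t) * s) / (b t - a t))
              * (ehat Q a b x t s \<bullet> xhat a b x t s)))) {0..1}"
proof -

  \<comment> \<open>Pulling the moving interval back to [0,1]\<close>
  note J0 = assms(1) and J1 = assms(2) and Q = assms(4) and ab = assms(15)
  define L where "L t = b t - a t" for t
  define L' where "L' t = b' t - a' t" for t
  define y where "y t s = a t + L t * s" for t s
  \<comment> \<open>The velocity of the point \<open>y t s\<close> at fixed reference coordinate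
    \<open>s\<close>.\<close>
  define w where "w t s = a' t + L' t * s" for t s
  define \<Omega> where "\<Omega> = Sigma T (\<lambda>t. {a t..b t})"
  obtain xt xs where
    xt: "continuous_on \<Omega> (\<lambda>(t, s). xt t s)" and xs: "continuous_on \<Omega> (\<lambda>(t, s). xs t s)"
    and dx: "\<And>t s. t \<in> T \<Longrightarrow> s \<in> {a t..b t} \<Longrightarrow>
       ((\<lambda>(t, s). x t s) has_derivative (\<lambda>(dt, ds). dt *\<^sub>R xt t s + ds *\<^sub>R xs t s)) (at (t, s) within \<Omega>)"
    and pde: "\<And>t s. t \<in> T \<Longrightarrow> s \<in> {a t..b t} \<Longrightarrow> xt t s = J0 *v (Q *v x t s)
       + J1 *v vector_derivative (\<lambda>\<sigma>. Q *v x t \<sigma>) (at s within {a t..b t})"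
    using assms(17) unfolding phs_solution_def Let_def \<Omega>_def by blast
  have L_pos: "0 < L t" if "t \<in> T" for t
    using ab[OF that] by (simp add: L_def)
  have y_in: "y t s \<in> {a t..b t}" if "t \<in> T" "s \<in> {0..1}" for t s
  proof -
    have "0 \<le> L t * s" "L t * s \<le> L t"
      using that L_pos[OF that(1)] by (auto simp: mult_left_le)
    then show ?thesis by (simp add: y_def L_def)
  qed
  have dL: "(L has_real_derivative L' t) (at t within T)" if "t \<in> T" for t
    unfolding L_def L'_def using assms(11,13) that by (auto intro!: derivative_eq_intros)
  have dy: "((\<lambda>\<tau>. y \<tau> s) has_real_derivative w t s) (at t within T)" if "t \<in> T" for t s
    unfolding y_def w_def using assms(11) dL that by (auto intro!: derivative_eq_intros)

  \<comment> \<open>Time derivative of the rescaled state\<close>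
  have dyc: "((\<lambda>\<tau>. (\<tau>, y \<tau> s)) has_derivative (\<lambda>h. (h, h * w t s))) (at t within T)"
    if "t \<in> T" for t s
    using dy[OF that, of s] by (auto simp: has_field_derivative_def mult_commute_abs intro!: derivative_eq_intros)
  have dxy: "((\<lambda>\<tau>. x \<tau> (y \<tau> s)) has_vector_derivative xt t (y t s) + w t s *\<^sub>R xs t (y t s))
      (at t within T)" if t: "t \<in> T" and s: "s \<in> {0..1}" for t s
  proof -
    \<comment> \<open>For fixed \<open>s\<close> in [0,1] the curve of points
      \<open>(\<tau>, y \<tau> s)\<close> stays in \<open>\<Omega>\<close>, so the total derivative
      within \<open>\<Omega>\<close> can be composed with it, also at the moving boundary.\<close>
    have "((\<lambda>\<tau>. (case (\<tau>, y \<tau> s) of (t, s) \<Rightarrow> x t s)) has_derivative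
        (\<lambda>h. case (h, h * w t s) of (dt, ds) \<Rightarrow> dt *\<^sub>R xt t (y t s) + ds *\<^sub>R xs t (y t s))) (at t within T)"
      by (rule has_derivative_in_compose[OF dyc[OF t] has_derivative_subset[OF dx[OF t y_in[OF t s]]]])
        (use y_in s in \<open>auto simp: \<Omega>_def\<close>)
    then show ?thesis
      by (simp add: has_vector_derivative_def scaleR_add_right)
  qed
  \<comment> \<open>Product rule: the first summand transports \<open>x\<close> along the moving
    point, the second differentiates the factor \<open>sqrt (L t)\<close>.\<close>
  define X where "X t s = sqrt (L t) *\<^sub>R (xt t (y t s) + w t s *\<^sub>R xs t (y t s))
      + (L' t / (2 * sqrt (L t))) *\<^sub>R x t (y t s)" for t s
  have xhat_eq: "xhat a b x t s = sqrt (L t) *\<^sub>R x t (y t s)" for t s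
    by (simp add: xhat_def L_def y_def)
  have dX: "((\<lambda>\<tau>. xhat a b x \<tau> s) has_vector_derivative X t s) (at t within T)"
    if t: "t \<in> T" and s: "s \<in> {0..1}" for t s
  proof -
    have "((\<lambda>\<tau>. sqrt (L \<tau>)) has_real_derivative L' t / (2 * sqrt (L t))) (at t within T)"
      using dL[OF t] L_pos[OF t] by (auto intro!: derivative_eq_intros simp: field_simps)
    then show ?thesis
      unfolding xhat_eq X_def by (rule has_vector_derivative_scaleR[OF _ dxy[OF t s]])
  qed
  \<comment> \<open>Nonempty interior rules out a one-point interval; otherwise derivatives within
    \<open>T\<close> would not be unique and \<open>vector_derivative\<close> would not be
    determined.\<close>
  have "T \<noteq> {t}" for t
    using assms(10) by auto
  then have not_bot: "at t within T \<noteq> bot" if "t \<in> T" for t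
    using connected_imp_perfect[of T t] that assms(9) is_interval_connected
    by (auto simp: trivial_limit_within)
  have vX: "vector_derivative (\<lambda>\<tau>. xhat a b x \<tau> s) (at t within T) = X t s"
    if "t \<in> T" "s \<in> {0..1}" for t s
    using vector_derivative_within[OF not_bot dX] that by blast

  \<comment> \<open>Joint continuity on the fixed strip\<close>
  have cx: "continuous_on \<Omega> (\<lambda>(t, s). x t s)"
    unfolding continuous_on_eq_continuous_within
    using has_derivative_continuous[OF dx] by (auto simp: \<Omega>_def)
  have ca: "continuous_on T a" "continuous_on T L"
    using assms(11) dL by (auto intro!: DERIV_continuous_on)
  have "continuous_on (T \<times> {0..1}) (\<lambda>p. h (fst p))" if "continuous_on T h" for h :: "real \<Rightarrow> real"
    by (rule continuous_on_compose2[OF that]) (auto intro!: continuous_intros)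
  note cfst = this[OF ca(1)] this[OF ca(2)] this[OF assms(12)] this[OF assms(14)]
  \<comment> \<open>Composition with this map carries continuity from \<open>\<Omega>\<close> to the
    product \<open>T \<times> {0..1}\<close>, the domain on which differentiation under the integral
    is performed.\<close>
  have cy: "continuous_on (T \<times> {0..1}) (\<lambda>p. (fst p, y (fst p) (snd p)))"
    unfolding y_def using cfst by (intro continuous_intros)
  have cy': "(\<lambda>p. (fst p, y (fst p) (snd p))) ` (T \<times> {0..1}) \<subseteq> \<Omega>"
    using y_in by (auto simp: \<Omega>_def)
  note cxy = continuous_on_compose2[OF cx cy cy', simplified]
    continuous_on_compose2[OF xt cy cy', simplified]
    continuous_on_compose2[OF xs cy cy', simplified]
  have cX: "continuous_on (T \<times> {0..1}) (\<lambda>(t, s). X t s)"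
    unfolding X_def w_def L'_def split_beta using cfst cxy
    by (intro continuous_intros) (auto dest!: L_pos)
  have cxhat: "continuous_on (T \<times> {0..1}) (\<lambda>(t, s). xhat a b x t s)"
    unfolding xhat_eq split_beta using cfst cxy by (intro continuous_intros)
  show ?thesis
  proof (intro ballI conjI)
    fix t s assume "t \<in> T" "s \<in> {0..1::real}"
    then show "(\<lambda>\<tau>. xhat a b x \<tau> s) differentiable (at t within T)"
      using dX differentiableI_vector by blast
  next

    \<comment> \<open>Differentiating the Hamiltonian under the integral\<close>
    fix t assume t: "t \<in> T"
    \<comment> \<open>The time \<open>t\<close> is bound anew, because the Leibniz rule asks for the
      derivative throughout \<open>T\<close>. Symmetry of \<open>Q\<close> merges the two product
      rule terms; the resulting 2 cancels the 1/2 in \<open>Hhat\<close>.\<close>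
    have "((\<lambda>\<tau>. xhat a b x \<tau> s \<bullet> (Q *v xhat a b x \<tau> s)) has_real_derivative
        2 * (ehat Q a b x t s \<bullet> X t s)) (at t within T)" if "t \<in> T" "s \<in> {0..1}" for t s
    proof -
      have "((\<lambda>\<tau>. Q *v xhat a b x \<tau> s) has_vector_derivative Q *v X t s) (at t within T)"
        by (rule bounded_linear.has_vector_derivative[OF matrix_vector_mul_bounded_linear dX[OF that]])
      from bounded_bilinear.has_vector_derivative[OF bounded_bilinear_inner dX[OF that] this]
      moreover have "xhat a b x t s \<bullet> (Q *v X t s) + X t s \<bullet> (Q *v xhat a b x t s)
          = 2 * (ehat Q a b x t s \<bullet> X t s)"
        using symmetric_inner_mult[OF Q, of "xhat a b x t s" "X t s"]
        by (simp add: ehat_def inner_commute)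
      ultimately show ?thesis
        unfolding has_real_derivative_iff_has_vector_derivative by simp
    qed
    moreover have "continuous_on (T \<times> {0..1}) (\<lambda>(t, s). 2 * (ehat Q a b x t s \<bullet> X t s))"
      unfolding ehat_def using cX cxhat
      by (auto simp: split_beta intro!: continuous_intros
        bounded_linear.continuous_on[OF matrix_vector_mul_bounded_linear])
    moreover have "(\<lambda>s. xhat a b x \<tau> s \<bullet> (Q *v xhat a b x \<tau> s)) integrable_on {0..1}"
      if "\<tau> \<in> T" for \<tau>
    proof -
      have "continuous_on {0..1} (\<lambda>s. case (\<tau>, s) of (t, s) \<Rightarrow> xhat a b x t s)"
        by (intro continuous_on_compose2[OF cxhat] continuous_intros) (use that in auto)
      then show ?thesis
        unfolding prod.case
        by (intro integrable_continuous_interval continuous_intros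
          bounded_linear.continuous_on[OF matrix_vector_mul_bounded_linear])
    qed
    ultimately have "((\<lambda>\<tau>. integral {0..1} (\<lambda>s. xhat a b x \<tau> s \<bullet> (Q *v xhat a b x \<tau> s)))
        has_real_derivative integral {0..1} (\<lambda>s. 2 * (ehat Q a b x t s \<bullet> X t s))) (at t within T)"
      using leibniz_rule_field_derivative[where a = "0::real" and b = 1 and U = T and ?x0.0 = t
          and f = "\<lambda>\<tau> s. xhat a b x \<tau> s \<bullet> (Q *v xhat a b x \<tau> s)"
          and fx = "\<lambda>\<tau> s. 2 * (ehat Q a b x \<tau> s \<bullet> X \<tau> s)"] t assms(9)
      by (simp add: is_interval_convex)
    then have "((\<lambda>\<tau>. Hhat Q (xhat a b x \<tau>)) has_real_derivative
        integral {0..1} (\<lambda>s. ehat Q a b x t s \<bullet> X t s)) (at t within T)"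
      unfolding Hhat_def by (auto intro!: derivative_eq_intros)
    also have "integral {0..1} (\<lambda>s. ehat Q a b x t s \<bullet> X t s) = integral {0..1} (\<lambda>s. ehat Q a b x t s \<bullet>
        vector_derivative (\<lambda>\<tau>. xhat a b x \<tau> s) (at t within T))"
      by (rule integral_cong) (simp add: vX[OF t])
    finally show "((\<lambda>\<tau>. Hhat Q (xhat a b x \<tau>)) has_real_derivative
        integral {0..1} (\<lambda>s. ehat Q a b x t s \<bullet>
          vector_derivative (\<lambda>\<tau>. xhat a b x \<tau> s) (at t within T))) (at t within T)" .
  next

    \<comment> \<open>Evaluating the power balance by boundary terms\<close>
    fix t assume t: "t \<in> T"
    define e where "e \<sigma> = Q *v x t \<sigma>" for \<sigma>
    \<comment> \<open>The antiderivative in \<open>s\<close>, written with the unscaled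
      \<open>e\<close> and \<open>x\<close>.\<close>
    define F where "F s = 1 / 2 * (e (y t s) \<bullet> (J1 *v e (y t s))) + 1 / 2 * (w t s * (e (y t s) \<bullet> x t (y t s)))"
      for s
    have dxs: "(x t has_vector_derivative xs t \<sigma>) (at \<sigma> within {a t..b t})"
      if "\<sigma> \<in> {a t..b t}" for \<sigma>
    proof -
      \<comment> \<open>The total derivative is restricted to the slice of \<open>\<Omega>\<close>
        at time \<open>t\<close>.\<close>
      have "((\<lambda>\<sigma>. (t, \<sigma>)) has_derivative (\<lambda>h. (0, h))) (at \<sigma> within {a t..b t})"
        by (auto intro!: derivative_eq_intros)
      from has_derivative_in_compose[OF this has_derivative_subset[OF dx[OF t that]]]
      have "((\<lambda>\<sigma>. (case (t, \<sigma>) of (t, s) \<Rightarrow> x t s)) has_derivative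
          (\<lambda>h. case (0, h) of (dt, ds) \<Rightarrow> dt *\<^sub>R xt t \<sigma> + ds *\<^sub>R xs t \<sigma>)) (at \<sigma> within {a t..b t})"
        using t by (auto simp: \<Omega>_def)
      then show ?thesis
        by (simp add: has_vector_derivative_def)
    qed
    have de: "(e has_vector_derivative Q *v xs t \<sigma>) (at \<sigma> within {a t..b t})"
      if "\<sigma> \<in> {a t..b t}" for \<sigma>
      unfolding e_def
      by (rule bounded_linear.has_vector_derivative[OF matrix_vector_mul_bounded_linear dxs[OF that]])
    \<comment> \<open>As \<open>a t < b t\<close>, derivatives within the closed interval are
      unique, so the spatial derivative in the differential equation is
      \<open>Q *v xs t \<sigma>\<close>.\<close>
    have xt_eq: "xt t \<sigma> = J0 *v e \<sigma> + J1 *v (Q *v xs t \<sigma>)" if "\<sigma> \<in> {a t..b t}" for \<sigma>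
      using pde[OF t that] vector_derivative_within_closed_interval[OF ab[OF t] that de[OF that]]
      by (simp add: e_def[abs_def])
    have ys: "(y t has_vector_derivative L t) (at s within {0..1})" for s
      unfolding y_def
      by (auto intro!: derivative_eq_intros simp flip: has_real_derivative_iff_has_vector_derivative)
    have yim: "y t ` {0..1} \<subseteq> {a t..b t}"
      using y_in[OF t] by auto
    have comp: "((\<lambda>s. u (y t s)) has_vector_derivative L t *\<^sub>R u' (y t s)) (at s within {0..1})"
      if "\<And>\<sigma>. \<sigma> \<in> {a t..b t} \<Longrightarrow> (u has_vector_derivative u' \<sigma>) (at \<sigma> within {a t..b t})" "s \<in> {0..1}"
      for u u' :: "real \<Rightarrow> real^'n" and s
      using vector_diff_chain_within[OF ys
          has_vector_derivative_within_subset[OF that(1)[OF y_in[OF t that(2)]] yim]]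
      by (simp add: o_def)
    have "(F has_vector_derivative ehat Q a b x t s \<bullet> X t s) (at s within {0..1})"
      if s: "s \<in> {0..1}" for s
    proof -
      let ?y = "y t s"
      note y = y_in[OF t s]
      have 1: "((\<lambda>s. x t (y t s)) has_vector_derivative L t *\<^sub>R xs t ?y) (at s within {0..1})"
        using comp[OF dxs s] .
      have 2: "((\<lambda>s. e (y t s)) has_vector_derivative L t *\<^sub>R (Q *v xs t ?y)) (at s within {0..1})"
        using comp[OF de s] .
      have 3: "((\<lambda>s. J1 *v e (y t s)) has_vector_derivative J1 *v (L t *\<^sub>R (Q *v xs t ?y))) (at s within {0..1})"
        by (rule bounded_linear.has_vector_derivative[OF matrix_vector_mul_bounded_linear 2])
      have 4: "(w t has_real_derivative L' t) (at s within {0..1})"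
        unfolding w_def by (auto intro!: derivative_eq_intros)
      note 5 = bounded_bilinear.has_vector_derivative[OF bounded_bilinear_inner 2 3]
        and 6 = bounded_bilinear.has_vector_derivative[OF bounded_bilinear_inner 2 1]
      have 7: "(F has_real_derivative
          1 / 2 * (e ?y \<bullet> (J1 *v (L t *\<^sub>R (Q *v xs t ?y))) + L t *\<^sub>R (Q *v xs t ?y) \<bullet> (J1 *v e ?y))
          + 1 / 2 * (L' t * (e ?y \<bullet> x t ?y)
            + (e ?y \<bullet> (L t *\<^sub>R xs t ?y) + L t *\<^sub>R (Q *v xs t ?y) \<bullet> x t ?y) * w t s)) (at s within {0..1})"
        unfolding F_def
        by (intro DERIV_add DERIV_cmult DERIV_mult 4 5[folded has_real_derivative_iff_has_vector_derivative]
            6[folded has_real_derivative_iff_has_vector_derivative])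
      \<comment> \<open>Symmetry of \<open>J1\<close> and of \<open>Q\<close> pairs up the product
        rule terms of \<open>F\<close>, which absorbs its factors 1/2, except on the
        \<open>L' t\<close> term.\<close>
      have J1e: "(Q *v xs t ?y) \<bullet> (J1 *v e ?y) = e ?y \<bullet> (J1 *v (Q *v xs t ?y))"
        by (rule symmetric_inner_mult[OF J1])
      have Qx: "(Q *v xs t ?y) \<bullet> x t ?y = e ?y \<bullet> xs t ?y"
        unfolding e_def by (metis inner_commute symmetric_inner_mult[OF Q])
      \<comment> \<open>The root factors are kept apart until positivity of \<open>L t\<close> turns
        them into \<open>L t\<close> and 1. Afterwards \<open>e \<bullet> xt\<close> loses its
        \<open>J0\<close> part by skewness.\<close>
      have "ehat Q a b x t s \<bullet> X t s = (sqrt (L t) * sqrt (L t)) * (e ?y \<bullet> xt t ?y + w t s * (e ?y \<bullet> xs t ?y))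
          + (sqrt (L t) / sqrt (L t)) * (L' t / 2 * (e ?y \<bullet> x t ?y))"
        by (simp add: ehat_def xhat_eq X_def e_def matrix_vector_mult_scaleR inner_add_right algebra_simps
            del: real_sqrt_mult_self)
      also have "\<dots> = L t * (e ?y \<bullet> (J1 *v (Q *v xs t ?y)) + w t s * (e ?y \<bullet> xs t ?y))
          + L' t / 2 * (e ?y \<bullet> x t ?y)"
        using L_pos[OF t] skew_inner_mult_self[OF J0, of "e ?y"] xt_eq[OF y]
        by (simp add: inner_add_right)
      finally show ?thesis
        using 7 J1e Qx
        by (simp add: has_real_derivative_iff_has_vector_derivative[symmetric] matrix_vector_mult_scaleR
            algebra_simps)
    qed
    then have "((\<lambda>s. ehat Q a b x t s \<bullet> X t s) has_integral F 1 - F 0) {0..1}"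
      by (intro fundamental_theorem_of_calculus) auto
    moreover have "F s = - (port_inner r (rows_mult r M (ehat Q a b x t s))
              (port_mult r S1 (rows_mult r M (ehat Q a b x t s))) / (b t - a t))
        + 1 / 2 * ((a' t + (b' t - a' t) * s) / (b t - a t)) * (ehat Q a b x t s \<bullet> xhat a b x t s)" for s
    proof -
      \<comment> \<open>Expressions quadratic in the rescaled variables carry a factor
        \<open>L t\<close>, which the division by \<open>b t - a t\<close> removes.\<close>
      have es: "ehat Q a b x t s = sqrt (L t) *\<^sub>R e (y t s)"
        by (simp add: ehat_def xhat_eq e_def matrix_vector_mult_scaleR)
      have sq: "sqrt (L t) * (sqrt (L t) * c) = L t * c" for c
        using L_pos[OF t] by (simp flip: mult.assoc)
      \<comment> \<open>The Dirac property is applied on the unit interval; the identity it yields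
        for \<open>S1\<close>, \<open>M\<close> and \<open>J1\<close> no longer mentions an
        interval.\<close>
      show ?thesis
        using L_pos[OF t] unfolding dirac_boundary_form[OF J0 zero_less_one assms(8)[OF zero_less_one]]
        by (simp add: xhat_eq F_def w_def L'_def es matrix_vector_mult_scaleR sq flip: L_def)
    qed
    ultimately have "((\<lambda>s. ehat Q a b x t s \<bullet> X t s) has_integral
         (- bracket01 (\<lambda>s. port_inner r (rows_mult r M (ehat Q a b x t s))
              (port_mult r S1 (rows_mult r M (ehat Q a b x t s))) / (b t - a t))
          + bracket01 (\<lambda>s. 1 / 2 * ((a' t + (b' t - a' t) * s) / (b t - a t))
              * (ehat Q a b x t s \<bullet> xhat a b x t s)))) {0..1}"
      by (simp add: bracket01_def algebra_simps)
    then show "((\<lambda>s. ehat Q a b x t s \<bullet> vector_derivative (\<lambda>\<tau>. xhat a b x \<tau> s) (at t within T))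
       has_integral
         (- bracket01 (\<lambda>s. port_inner r (rows_mult r M (ehat Q a b x t s))
              (port_mult r S1 (rows_mult r M (ehat Q a b x t s))) / (b t - a t))
          + bracket01 (\<lambda>s. 1 / 2 * ((a' t + (b' t - a' t) * s) / (b t - a t))
              * (ehat Q a b x t s \<bullet> xhat a b x t s)))) {0..1}"
      by (rule has_integral_eq[rotated]) (simp add: vX[OF t])
  qed
qed

end
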